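(* Let $I\subset(0,\infty)$ be an interval with interior $I^\circ$, let $f:I\to\mathbb{R}$ be differentiable on $I^\circ$, let $m\in(0,1]$, let $a,b/m\in I^\circ$ with $a<b$, and suppose $f'\in L[a,b]$. Let $\alpha\in[0,1]$ and $q\ge 1$. If $|f'|^q$ is harmonically $(\alpha,m)$-convex on $[a,b/m]$, then $$\left|\frac{f(a)+f(b)}{2}-\frac{ab}{b-a}\int_a^b\frac{f(x)}{x^2}\,dx\right|\le\frac{ab(b-a)}{2}\,\lambda(0,1;a,b)^{1-\frac1q}\left[\lambda(\alpha,1;a,b)|f'(a)|^q+m\,\mu(\alpha,1;a,b)|f'(b/m)|^q\right]^{1/q},$$ where, for $r\ge1$, $$\lambda(\alpha,r;a,b)=\frac{\beta(1,\alpha+2)}{b^{2r}}\,{}_2F_1\left(2r,1;\alpha+3;1-\frac ab\right)-\frac{\beta(2,\alpha+1)}{b^{2r}}\,{}_2F_1\left(2r,2;\alpha+3;1-\frac ab\right)+\frac{2^{2r-\alpha}\beta(2,\alpha+1)}{(a+b)^{2r}}\,{}_2F_1\left(2r,2;\alpha+3;1-\frac{2a}{a+b}\right),$$ $$\mu(\alpha,r;a,b)=\lambda(0,r;a,b)-\lambda(\alpha,r;a,b).$$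
   Context: For $\alpha\in[0,1]$, $m\in(0,1]$ and an interval $J\subset(0,\infty)$, a real function $g$ is harmonically $(\alpha,m)$-convex on $J$ if $$g\left(\frac{mxy}{mty+(1-t)x}\right)\le t^{\alpha}g(x)+m(1-t^{\alpha})g(y)$$ for all $x,y\in J$ and $t\in[0,1]$ such that the point $\frac{mxy}{mty+(1-t)x}=\left(\frac tx+\frac{1-t}{my}\right)^{-1}$ lies in $J$. $\beta(x,y)=\frac{\Gamma(x)\Gamma(y)}{\Gamma(x+y)}=\int_0^1t^{x-1}(1-t)^{y-1}dt$ for $x,y>0$ is the Euler Beta function, and ${}_2F_1(A,B;C;z)=\frac{1}{\beta(B,C-B)}\int_0^1t^{B-1}(1-t)^{C-B-1}(1-zt)^{-A}dt$ for $C>B>0$, $|z|<1$ is the hypergeometric function. $L[a,b]$ denotes the Lebesgue integrable functions on $[a,b]$. *)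

theory Defs
  imports "HOL-Analysis.Analysis"
begin

text \<open>Real powers of nonnegative bases with \<open>0\<^sup>0 = 1\<close>; plain \<^term>\<open>(powr)\<close> has
  \<open>0 powr 0 = 0\<close>, which would change the convexity condition for \<open>\<alpha> = 0\<close>, \<open>t = 0\<close>.\<close>

definition rpow :: "real \<Rightarrow> real \<Rightarrow> real" where
  "rpow t \<alpha> = (if \<alpha> = 0 then 1 else t powr \<alpha>)"

definition harmonically_convex_on :: "real \<Rightarrow> real \<Rightarrow> real set \<Rightarrow> (real \<Rightarrow> real) \<Rightarrow> bool" where
  "harmonically_convex_on \<alpha> m J g \<longleftrightarrow>
     (\<forall>x\<in>J. \<forall>y\<in>J. \<forall>t\<in>{0..1}.
        m * x * y / (m * t * y + (1 - t) * x) \<in> J \<longrightarrow>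
        g (m * x * y / (m * t * y + (1 - t) * x))
          \<le> rpow t \<alpha> * g x + m * (1 - rpow t \<alpha>) * g y)"

text \<open>Euler's integral, meaningful for \<open>C > B > 0\<close> and \<open>\<bar>z\<bar> < 1\<close>. There the integrand is nonnegative,
  so the gauge integral is the Lebesgue integral; the value of \<^term>\<open>(powr)\<close> at base \<open>0\<close>
  matters only at the two endpoints.\<close>

definition hyp2F1 :: "real \<Rightarrow> real \<Rightarrow> real \<Rightarrow> real \<Rightarrow> real" where
  "hyp2F1 A B C z =
     1 / Beta B (C - B) *
     integral {0..1} (\<lambda>t. t powr (B - 1) * (1 - t) powr (C - B - 1) * (1 - z * t) powr (- A))"

definition hc_lambda :: "real \<Rightarrow> real \<Rightarrow> real \<Rightarrow> real \<Rightarrow> real" where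
  "hc_lambda \<alpha> r a b =
     Beta 1 (\<alpha> + 2) / b powr (2 * r) * hyp2F1 (2 * r) 1 (\<alpha> + 3) (1 - a / b)
     - Beta 2 (\<alpha> + 1) / b powr (2 * r) * hyp2F1 (2 * r) 2 (\<alpha> + 3) (1 - a / b)
     + 2 powr (2 * r - \<alpha>) * Beta 2 (\<alpha> + 1) / (a + b) powr (2 * r)
         * hyp2F1 (2 * r) 2 (\<alpha> + 3) (1 - 2 * a / (a + b))"

definition hc_mu :: "real \<Rightarrow> real \<Rightarrow> real \<Rightarrow> real \<Rightarrow> real" where
  "hc_mu \<alpha> r a b = hc_lambda 0 r a b - hc_lambda \<alpha> r a b"

end

theory Submission
  imports Defs
begin

text \<open>The harmonic mean \<open>u t = a * b / (t * b + (1 - t) * a)\<close> parametrises \<open>[a, b]\<close>. Integrating by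
  parts along it expresses the trapezoidal error as
  \<open>a * b * (b - a) / 2\<close> times the integral over \<open>[0, 1]\<close> of
  \<open>(1 - 2 * t) / (t * b + (1 - t) * a)\<^sup>2 * f' (u t)\<close> (\<open>trapezoid_harmonic_identity\<close>).

  Since \<open>u t\<close> is also the point that the definition of harmonic convexity assigns to \<open>a\<close>, \<open>b / m\<close> and
  \<open>t\<close>, the hypothesis bounds the \<open>q\<close>-th power of \<open>\<bar>f' (u t)\<bar>\<close> by a combination of its values at
  \<open>a\<close> and \<open>b / m\<close> with coefficients \<open>t\<^sup>\<alpha>\<close> and \<open>m * (1 - t\<^sup>\<alpha>)\<close>. The power mean inequality with
  weight \<open>\<bar>1 - 2 * t\<bar> / (t * b + (1 - t) * a)\<^sup>2\<close> then yields the estimate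
  (\<open>weighted_power_mean_bound\<close>). It remains to recognise the integrals of the weight, and of the
  weight times \<open>t\<^sup>\<alpha>\<close>, as the constants \<open>hc_lambda\<close> (\<open>hc_lambda_has_integral\<close>).\<close>

section \<open>A power mean inequality\<close>

text \<open>Young's inequality linearises the power \<open>q\<close>: the free parameter \<open>c\<close> will later be tuned to the
  size of the integrals, so that integrating these linear bounds gives a sharp inequality.\<close>

lemma le_of_powr_le_Young:
  fixes h G c q :: real
  assumes "0 \<le> h" "h powr q \<le> G" "0 < c" "1 \<le> q"
  shows "h \<le> c powr (1 - q) / q * G + (1 - 1 / q) * c"
proof (cases "h = 0")
  case True
  have "0 \<le> G" using assms(1,2) by (meson order_trans powr_ge_zero)
  with True assms show ?thesis by simp
next
  case False
  with assms have h: "0 < h" by simp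
  have "h = (h powr q * c powr (1 - q)) powr (1 / q) * c powr (1 - 1 / q)"
  proof -
    have "(h powr q * c powr (1 - q)) powr (1 / q) * c powr (1 - 1 / q)
        = h powr 1 * (c powr ((1 - q) / q) * c powr (1 - 1 / q))"
      using h assms by (simp add: powr_mult powr_powr)
    also have "c powr ((1 - q) / q) * c powr (1 - 1 / q) = 1"
      using assms by (simp add: powr_add [symmetric] field_simps)
    finally show ?thesis using h by simp
  qed
  also have "\<dots> \<le> 1 / q * (h powr q * c powr (1 - q)) + (1 - 1 / q) * c"
    using h assms by (intro Youngs_inequality_0) auto
  also have "\<dots> \<le> c powr (1 - q) / q * G + (1 - 1 / q) * c"
    using assms by (simp add: divide_simps mult.commute mult_right_mono)
  finally show ?thesis .
qed

text \<open>The optimal parameter satisfies \<open>c powr q = B / W\<close>, which makes the two summands combine to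
  \<open>c * W\<close>. If \<open>B = 0\<close> this value is not positive, and letting \<open>c\<close> tend to \<open>0\<close> gives the claim.\<close>

lemma Young_bounds_imp_geometric_mean:
  fixes X B W q :: real
  assumes X: "\<And>c. 0 < c \<Longrightarrow> X \<le> c powr (1 - q) / q * B + (1 - 1 / q) * c * W"
    and "0 \<le> B" "0 < W" "1 \<le> q"
  shows "X \<le> W powr (1 - 1 / q) * B powr (1 / q)"
proof (cases "B = 0")
  case True
  have "X \<le> 0 + e" if "0 < e" for e
  proof -
    have "X \<le> (1 - 1 / q) * (e / W) * W"
      using X [of "e / W"] True that assms by simp
    also have "\<dots> \<le> 0 + e"
      using that assms by (simp add: field_simps)
    finally show ?thesis .
  qed
  then have "X \<le> 0" by (rule field_le_epsilon)
  with True show ?thesis by simp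
next
  case False
  with assms have B: "0 < B" by simp
  define c where "c = (B / W) powr (1 / q)"
  have c: "0 < c" using B assms by (simp add: c_def)
  have "c powr q = B / W"
    using B assms by (simp add: c_def powr_powr)
  then have "c powr (1 - q) * B = c * W"
    using c B assms by (simp add: powr_diff field_simps)
  then have "c powr (1 - q) / q * B + (1 - 1 / q) * c * W = c * W"
    using assms by (simp add: field_simps)
  also have "\<dots> = W powr (1 - 1 / q) * B powr (1 / q)"
    using B assms by (simp add: c_def powr_divide powr_diff)
  finally show ?thesis using X [OF c] by simp
qed

text \<open>A power mean (Hoelder) inequality with a majorant \<open>G\<close> of the power built in. Because Young's
  inequality is applied pointwise before integrating, only integrals of \<open>\<phi>\<close>, \<open>w\<close> and \<open>w * G\<close> enter,
  and the argument works for the gauge integral. This matches the application, where \<open>G\<close>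
  is an explicit function but \<open>h\<close> is an arbitrary derivative.\<close>

lemma weighted_power_mean_bound:
  fixes \<phi> w h G :: "'a :: euclidean_space \<Rightarrow> real"
  assumes "1 \<le> q"
    and \<phi>: "(\<phi> has_integral X) S"
    and w: "(w has_integral W) S" "0 < W" "\<And>t. t \<in> S \<Longrightarrow> 0 \<le> w t"
    and wG: "((\<lambda>t. w t * G t) has_integral B) S"
    and h: "\<And>t. t \<in> S \<Longrightarrow> 0 \<le> h t" "\<And>t. t \<in> S \<Longrightarrow> h t powr q \<le> G t"
    and le: "\<And>t. t \<in> S \<Longrightarrow> \<bar>\<phi> t\<bar> \<le> w t * h t"
  shows "\<bar>X\<bar> \<le> W powr (1 - 1 / q) * B powr (1 / q)"
proof (rule Young_bounds_imp_geometric_mean)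
  have "0 \<le> G t" if "t \<in> S" for t
    using h(2) [OF that] by (meson order_trans powr_ge_zero)
  then show "0 \<le> B"
    using w(3) by (intro has_integral_nonneg [OF wG]) simp
next
  fix c :: real assume c: "0 < c"
  let ?g = "\<lambda>t. c powr (1 - q) / q * (w t * G t) + (1 - 1 / q) * c * w t"
  have g: "(?g has_integral c powr (1 - q) / q * B + (1 - 1 / q) * c * W) S"
    by (intro has_integral_add has_integral_mult_right wG w)
  have "norm (\<phi> t) \<le> ?g t" if t: "t \<in> S" for t
  proof -
    have "w t * h t \<le> w t * (c powr (1 - q) / q * G t + (1 - 1 / q) * c)"
      by (intro mult_left_mono le_of_powr_le_Young h w c assms t)
    with le [OF t] show ?thesis by (simp add: algebra_simps)
  qed
  then have "norm (integral S \<phi>) \<le> integral S ?g"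
    using \<phi> g by (intro integral_norm_bound_integral) auto
  then show "\<bar>X\<bar> \<le> c powr (1 - q) / q * B + (1 - 1 / q) * c * W"
    using \<phi> g by (simp add: integral_unique)
qed (use assms in auto)

section \<open>The constants as weighted moments\<close>

text \<open>Division by the Beta function in the definition of the hypergeometric function is harmless because
  the Beta function is positive here.\<close>

lemma Beta_mult_hyp2F1:
  assumes "0 < B" "B < C"
  shows "Beta B (C - B) * hyp2F1 A B C z =
    integral {0..1} (\<lambda>t. t powr (B - 1) * (1 - t) powr (C - B - 1) * (1 - z * t) powr (- A))"
proof -
  have "Beta B (C - B) > 0"
    using assms by (simp add: Beta_def Gamma_real_pos)
  then show ?thesis by (simp add: hyp2F1_def)
qed

text \<open>The orientation-reversing substitutions that carry Euler's integrals to integrals in the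
  parameter of the harmonic mean; only \<open>c = k = 1\<close> and \<open>c = k = 1 / 2\<close> occur below.\<close>

lemma integral_reflected_affine:
  fixes F :: "real \<Rightarrow> real"
  assumes "0 < k" and "continuous_on {c - k..c} F"
  shows "((\<lambda>s. F (c - k * s)) has_integral integral {c - k..c} F / k) {0..1}"
proof -
  have "((\<lambda>s. (- k) *\<^sub>R F (c - k * s)) has_integral
      (integral {c - k * 0..c - k * 1} F - integral {c - k * 1..c - k * 0} F)) {0..1}"
  proof (rule has_integral_substitution_general [where s = "{}" and c = "c - k" and d = c])
    show "(\<lambda>s. c - k * s) ` {0..1} \<subseteq> {c - k..c}"
      using assms(1) by (auto simp: mult_left_le)
  qed (use assms in \<open>auto intro!: continuous_intros derivative_eq_intros\<close>)
  then have "((\<lambda>s. (- 1 / k) *\<^sub>R ((- k) *\<^sub>R F (c - k * s))) has_integral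
      (- 1 / k) *\<^sub>R (integral {c - k * 0..c - k * 1} F - integral {c - k * 1..c - k * 0} F)) {0..1}"
    by (rule has_integral_cmul)
  then show ?thesis using assms(1) by simp
qed

text \<open>Unlike \<open>t powr \<alpha>\<close>, the function is continuous at \<open>0\<close> even for \<open>\<alpha> = 0\<close>, so the weights
  below are integrable by continuity.\<close>

lemma continuous_on_rpow:
  assumes "0 \<le> \<alpha>"
  shows "continuous_on {0..} (\<lambda>t. rpow t \<alpha>)"
proof (cases "\<alpha> = 0")
  case False
  with assms show ?thesis
    unfolding rpow_def by (auto intro!: continuous_on_powr' continuous_on_id continuous_on_const)
qed (simp add: rpow_def)

lemma one_minus_mult_pos:
  fixes z s :: real
  assumes "z < 1" "0 < s" "s < 1"
  shows "0 < 1 - z * s"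
  using mult_strict_right_mono [OF assms(1,2)] assms(3) by simp

lemma convex_mean_in_interval:
  fixes a b t :: real
  assumes "a < b" "t \<in> {0..1}"
  shows "t * b + (1 - t) * a \<in> {a..b}"
proof -
  have "t * b + (1 - t) * a = a + t * (b - a)" by (simp add: algebra_simps)
  moreover have "0 \<le> t * (b - a)" "t * (b - a) \<le> b - a"
    using assms by (auto intro: mult_left_le_one_le)
  ultimately show ?thesis by simp
qed

lemma harmonic_weight_continuous:
  fixes a b \<alpha> r :: real
  assumes "0 < a" "a < b" "0 \<le> \<alpha>"
  shows "continuous_on {0..1} (\<lambda>t. rpow t \<alpha> * (t * b + (1 - t) * a) powr (- 2 * r))"
proof -
  have "t * b + (1 - t) * a \<noteq> 0" if "t \<in> {0..1}" for t
    using convex_mean_in_interval [OF assms(2) that] assms(1) by auto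
  then show ?thesis
    using assms by (auto intro!: continuous_intros continuous_on_subset [OF continuous_on_rpow])
qed

text \<open>This unmasks the combination of hypergeometric values as a weighted moment. Writing \<open>g\<close> for the
  factor next to \<open>\<bar>1 - 2 * t\<bar>\<close>, its three terms are the integral of \<open>t * g t\<close> and minus the
  integral of \<open>(1 - t) * g t\<close> over the unit interval, and twice the integral of \<open>(1 - 2 * t) * g t\<close> over its
  left half.\<close>

lemma hc_lambda_has_integral:
  fixes a b \<alpha> r :: real
  assumes "0 < a" "a < b" "0 \<le> \<alpha>"
  shows "((\<lambda>t. \<bar>1 - 2 * t\<bar> * (rpow t \<alpha> * (t * b + (1 - t) * a) powr (- 2 * r)))
    has_integral hc_lambda \<alpha> r a b) {0..1}"
proof -
  define g where "g t = rpow t \<alpha> * (t * b + (1 - t) * a) powr (- 2 * r)" for t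
  have cont: "continuous_on {0..1} g"
    unfolding g_def by (rule harmonic_weight_continuous [OF assms])
  note cont' = continuous_on_subset [OF cont]
  have g_eq: "g t = t powr \<alpha> * (a + t * (b - a)) powr (- 2 * r)" if "0 < t" for t
    using that by (simp add: g_def rpow_def algebra_simps)
  \<comment> \<open>The reflection \<open>t = 1 - s\<close> turns the mean of \<open>a\<close> and \<open>b\<close> into \<open>b * (1 - z * s)\<close>, the shape
    of the last factor in Euler's integrand.\<close>
  have g_reflect: "g (1 - s)
      = (1 - s) powr \<alpha> * ((1 - (1 - a / b) * s) powr (- (2 * r)) / b powr (2 * r))"
    if s: "0 < s" "s < 1" for s
  proof -
    have "a + (1 - s) * (b - a) = b * (1 - (1 - a / b) * s)"
      using assms by (simp add: field_simps)
    moreover have "1 - (1 - a / b) * s > 0"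
      using s assms by (intro one_minus_mult_pos) (auto simp: field_simps)
    ultimately show ?thesis
      using s assms by (simp add: g_eq powr_mult powr_minus divide_inverse mult_ac)
  qed
  have K1: "Beta 1 (\<alpha> + 2) / b powr (2 * r) * hyp2F1 (2 * r) 1 (\<alpha> + 3) (1 - a / b)
      = integral {0..1} (\<lambda>t. t * g t)"
  proof -
    let ?f = "\<lambda>s. s powr (1 - 1) * (1 - s) powr ((\<alpha> + 3) - 1 - 1)
        * (1 - (1 - a / b) * s) powr (- (2 * r))"
    have "((\<lambda>s. (1 - 1 * s) * g (1 - 1 * s)) has_integral integral {1 - 1..1} (\<lambda>t. t * g t) / 1) {0..1}"
      by (rule integral_reflected_affine [where F = "\<lambda>t. t * g t"])
         (auto intro!: continuous_intros cont')
    then have "((\<lambda>s. b powr (2 * r) * ((1 - s) * g (1 - s))) has_integral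
        b powr (2 * r) * integral {0..1} (\<lambda>t. t * g t)) {0..1}"
      by (intro has_integral_mult_right) simp
    then have "(?f has_integral b powr (2 * r) * integral {0..1} (\<lambda>t. t * g t)) {0..1}"
      \<comment> \<open>The endpoints are left out because the factor \<open>s powr (1 - 1)\<close> is \<open>0\<close> at \<open>s = 0\<close>.\<close>
    proof (rule has_integral_spike_finite [of "{0, 1}", rotated 2])
      fix s :: real assume "s \<in> {0..1} - {0, 1}"
      then have s: "0 < s" "s < 1" by auto
      have "(1 - s) powr (\<alpha> + 3 - 1 - 1) = (1 - s) * (1 - s) powr \<alpha>"
        using s powr_add [of "1 - s" 1 \<alpha>] by (simp add: add.commute)
      then show "?f s = b powr (2 * r) * ((1 - s) * g (1 - s))"
        using g_reflect [OF s] s assms by simp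
    qed auto
    with Beta_mult_hyp2F1 [of 1 "\<alpha> + 3" "2 * r" "1 - a / b"] assms show ?thesis
      by (simp add: integral_unique field_simps)
  qed
  have K2: "Beta 2 (\<alpha> + 1) / b powr (2 * r) * hyp2F1 (2 * r) 2 (\<alpha> + 3) (1 - a / b)
      = integral {0..1} (\<lambda>t. (1 - t) * g t)"
  proof -
    let ?f = "\<lambda>s. s powr (2 - 1) * (1 - s) powr ((\<alpha> + 3) - 2 - 1)
        * (1 - (1 - a / b) * s) powr (- (2 * r))"
    have "((\<lambda>s. (1 - (1 - 1 * s)) * g (1 - 1 * s)) has_integral
        integral {1 - 1..1} (\<lambda>t. (1 - t) * g t) / 1) {0..1}"
      by (rule integral_reflected_affine [where F = "\<lambda>t. (1 - t) * g t"])
         (auto intro!: continuous_intros cont')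
    then have "((\<lambda>s. b powr (2 * r) * (s * g (1 - s))) has_integral
        b powr (2 * r) * integral {0..1} (\<lambda>t. (1 - t) * g t)) {0..1}"
      by (intro has_integral_mult_right) simp
    then have "(?f has_integral b powr (2 * r) * integral {0..1} (\<lambda>t. (1 - t) * g t)) {0..1}"
    proof (rule has_integral_spike_finite [of "{0, 1}", rotated 2])
      fix s :: real assume "s \<in> {0..1} - {0, 1}"
      then have s: "0 < s" "s < 1" by auto
      show "?f s = b powr (2 * r) * (s * g (1 - s))"
        using g_reflect [OF s] s assms by simp
    qed auto
    with Beta_mult_hyp2F1 [of 2 "\<alpha> + 3" "2 * r" "1 - a / b"] assms show ?thesis
      by (simp add: integral_unique field_simps)
  qed
  \<comment> \<open>Here \<open>t = (1 - s) / 2\<close> runs only over the left half, where the mean becomes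
    \<open>(a + b) * (1 - z * s) / 2\<close>.\<close>
  have K3: "2 powr (2 * r - \<alpha>) * Beta 2 (\<alpha> + 1) / (a + b) powr (2 * r)
        * hyp2F1 (2 * r) 2 (\<alpha> + 3) (1 - 2 * a / (a + b))
      = 2 * integral {0..1/2} (\<lambda>t. (1 - 2 * t) * g t)"
  proof -
    let ?z = "1 - 2 * a / (a + b)"
    let ?k = "2 powr (\<alpha> - 2 * r) * (a + b) powr (2 * r)"
    let ?f = "\<lambda>s. s powr (2 - 1) * (1 - s) powr ((\<alpha> + 3) - 2 - 1) * (1 - ?z * s) powr (- (2 * r))"
    have scale: "(c * x / 2) powr (- 2 * r) = x powr (- (2 * r)) * (2 powr (2 * r) / c powr (2 * r))"
      if "0 < c" "0 < x" for c x :: real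
      using that by (simp add: powr_mult powr_divide powr_minus field_simps)
    let ?J = "integral {0..1/2} (\<lambda>t. (1 - 2 * t) * g t)"
    have "((\<lambda>s. (1 - 2 * (1/2 - 1/2 * s)) * g (1/2 - 1/2 * s)) has_integral
        integral {1/2 - 1/2..1/2} (\<lambda>t. (1 - 2 * t) * g t) / (1/2)) {0..1}"
      by (rule integral_reflected_affine [where F = "\<lambda>t. (1 - 2 * t) * g t"])
         (auto intro!: continuous_intros cont')
    then have "((\<lambda>s. ?k * (s * g (1/2 - 1/2 * s))) has_integral ?k * (2 * ?J)) {0..1}"
      by (intro has_integral_mult_right) (simp add: algebra_simps)
    then have "(?f has_integral ?k * (2 * ?J)) {0..1}"
    proof (rule has_integral_spike_finite [of "{0, 1}", rotated 2])
      fix s :: real assume "s \<in> {0..1} - {0, 1}"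
      then have s: "0 < s" "s < 1" by auto
      have A: "a + (1/2 - 1/2 * s) * (b - a) = (a + b) * (1 - ?z * s) / 2"
        using assms by (simp add: field_simps)
      have pos: "1 - ?z * s > 0"
        using s assms by (intro one_minus_mult_pos) (auto simp: field_simps)
      have half: "(1/2 - 1/2 * s) powr \<alpha> = (1 - s) powr \<alpha> / 2 powr \<alpha>"
        using s by (simp add: powr_divide [symmetric] diff_divide_distrib)
      have "g (1/2 - 1/2 * s)
          = (1 - s) powr \<alpha> / 2 powr \<alpha> * ((a + b) * (1 - ?z * s) / 2) powr (- 2 * r)"
        unfolding half [symmetric] A [symmetric] using s by (intro g_eq) simp
      also have "((a + b) * (1 - ?z * s) / 2) powr (- 2 * r)
          = (1 - ?z * s) powr (- (2 * r)) * (2 powr (2 * r) / (a + b) powr (2 * r))"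
        using pos assms by (intro scale) auto
      finally show "?f s = ?k * (s * g (1/2 - 1/2 * s))"
        using s assms by (simp add: powr_diff)
    qed auto
    then have "Beta 2 (\<alpha> + 1) * hyp2F1 (2 * r) 2 (\<alpha> + 3) ?z = ?k * (2 * ?J)"
      using Beta_mult_hyp2F1 [of 2 "\<alpha> + 3" "2 * r" ?z] assms
      by (simp add: integral_unique add.commute)
    then have "2 powr (2 * r - \<alpha>) / (a + b) powr (2 * r) *
        (Beta 2 (\<alpha> + 1) * hyp2F1 (2 * r) 2 (\<alpha> + 3) ?z) = 2 * ?J"
      using assms by (simp add: powr_diff)
    then show ?thesis by (simp add: mult.assoc)
  qed
  \<comment> \<open>The absolute value is recovered from \<open>\<bar>1 - 2 * t\<bar> = (2 * t - 1) + 2 * max 0 (1 - 2 * t)\<close>.\<close>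
  have tent: "((\<lambda>t. (t * g t - (1 - t) * g t) + (if t \<in> {0..1/2} then 2 * ((1 - 2 * t) * g t) else 0))
      has_integral (integral {0..1} (\<lambda>t. t * g t) - integral {0..1} (\<lambda>t. (1 - t) * g t)
        + 2 * integral {0..1/2} (\<lambda>t. (1 - 2 * t) * g t))) {0..1}"
  proof (intro has_integral_add has_integral_diff)
    have "((\<lambda>t. 2 * ((1 - 2 * t) * g t)) has_integral
        2 * integral {0..1/2} (\<lambda>t. (1 - 2 * t) * g t)) {0..1/2}"
      by (intro has_integral_mult_right integrable_integral integrable_continuous_real
          continuous_intros cont') auto
    then show "((\<lambda>t. if t \<in> {0..1/2} then 2 * ((1 - 2 * t) * g t) else 0) has_integral
        2 * integral {0..1/2} (\<lambda>t. (1 - 2 * t) * g t)) {0..1}"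
      by (subst has_integral_restrict) auto
  qed (intro integrable_integral integrable_continuous_real continuous_intros cont; simp)+
  have "\<bar>1 - 2 * t\<bar> * g t =
      (t * g t - (1 - t) * g t) + (if t \<in> {0..1/2} then 2 * ((1 - 2 * t) * g t) else 0)"
    if "t \<in> {0..1}" for t
    using that by (auto simp: abs_if algebra_simps)
  then have "((\<lambda>t. \<bar>1 - 2 * t\<bar> * g t) has_integral hc_lambda \<alpha> r a b) {0..1}"
    using tent unfolding hc_lambda_def K1 K2 K3 by (subst has_integral_cong) auto
  then show ?thesis by (simp add: g_def)
qed

text \<open>Positivity is needed because for \<open>q = 1\<close> the bound contains the power
  \<open>hc_lambda 0 1 a b powr 0\<close>, which is \<open>1\<close> only for a nonzero base.\<close>

lemma hc_lambda_0_pos: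
  assumes "0 < a" "a < b"
  shows "0 < hc_lambda 0 r a b"
proof -
  let ?w = "\<lambda>t. \<bar>1 - 2 * t\<bar> * (rpow t 0 * (t * b + (1 - t) * a) powr (- 2 * r))"
  have "integral {0..1} ?w = hc_lambda 0 r a b"
    using hc_lambda_has_integral assms by (intro integral_unique) auto
  moreover have "integral {0..1} ?w \<ge> 0"
    by (rule Henstock_Kurzweil_Integration.integral_nonneg)
       (use hc_lambda_has_integral [of a b 0 r] assms in \<open>auto simp: rpow_def has_integral_integrable\<close>)
  moreover have "integral {0..1} ?w \<noteq> 0"
  proof
    \<comment> \<open>A continuous nonnegative function with zero integral vanishes, but the weight is positive
      at \<open>0\<close>.\<close>
    assume "integral {0..1} ?w = 0"
    then have "\<forall>t\<in>{0..1}. ?w t = 0"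
      using assms harmonic_weight_continuous [of a b 0 r]
      by (subst (asm) integral_eq_0_iff) (auto intro!: continuous_intros simp: rpow_def)
    then have "?w 0 = 0" by (rule bspec) simp
    with assms show False by (simp add: rpow_def)
  qed
  ultimately show ?thesis by linarith
qed

section \<open>The trapezoidal error as an integral of the derivative\<close>

text \<open>Along \<open>u t = a * b / (t * b + (1 - t) * a)\<close>, which runs from \<open>b\<close> to \<open>a\<close>, integrate the derivative
  of \<open>(1 - 2 * t) * f (u t)\<close>. Its boundary values give \<open>- (f a + f b)\<close>, and the substitution
  \<open>x = u t\<close> turns the integral of \<open>f (u t)\<close> into that of \<open>f x / x\<^sup>2\<close>. The
  fundamental theorem for the gauge integral makes every derivative integrable, which is why
  integrability of the left-hand side can be part of the conclusion.\<close>

lemma trapezoid_harmonic_identity: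
  fixes f f' :: "real \<Rightarrow> real" and a b :: real
  assumes "0 < a" "a < b"
    and f: "\<And>x. x \<in> {a..b} \<Longrightarrow> (f has_real_derivative f' x) (at x)"
  shows "((\<lambda>t. (1 - 2 * t) * (t * b + (1 - t) * a) powr (- 2) * f' (a * b / (t * b + (1 - t) * a)))
    has_integral (2 / (a * b * (b - a)) * ((f a + f b) / 2
      - a * b / (b - a) * integral {a..b} (\<lambda>x. f x / x\<^sup>2)))) {0..1}"
proof -
  define A where "A t = t * b + (1 - t) * a" for t
  define u where "u t = a * b / A t" for t
  have A: "a \<le> A t" "A t \<le> b" "0 < A t" if "t \<in> {0..1}" for t
    using convex_mean_in_interval [OF assms(2) that] assms(1) by (auto simp: A_def)
  have u_mem: "u t \<in> {a..b}" if "t \<in> {0..1}" for t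
    using A [OF that] assms by (simp add: u_def field_simps)
  have u_deriv: "(u has_real_derivative - (a * b * (b - a)) / (A t)\<^sup>2) (at t within {0..1})"
    if "t \<in> {0..1}" for t
  proof -
    have "(u has_real_derivative - (a * b * (b - a)) / (A t * A t)) (at t within {0..1})"
      unfolding u_def
      by (rule derivative_eq_intros refl | use A(3) [OF that] in \<open>simp add: A_def algebra_simps\<close>)+
    then show ?thesis by (simp add: power2_eq_square)
  qed
  have fu_deriv: "((\<lambda>t. f (u t)) has_real_derivative f' (u t) * (- (a * b * (b - a)) / (A t)\<^sup>2))
      (at t within {0..1})" if "t \<in> {0..1}" for t
    using f [OF u_mem [OF that]] u_deriv [OF that] by (rule DERIV_chain2)
  have contf: "continuous_on {a..b} f"
    using f by (intro DERIV_continuous_on) (blast intro: has_field_derivative_at_within)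
  have "((\<lambda>t. (- (a * b * (b - a)) / (A t)\<^sup>2) *\<^sub>R (f (u t) / (u t)\<^sup>2)) has_integral
      (integral {u 0..u 1} (\<lambda>x. f x / x\<^sup>2) - integral {u 1..u 0} (\<lambda>x. f x / x\<^sup>2))) {0..1}"
  proof (rule has_integral_substitution_general [where s = "{}" and c = a and d = b])
    show "continuous_on {a..b} (\<lambda>x. f x / x\<^sup>2)"
      using assms by (intro continuous_intros contf) auto
    show "continuous_on {0..1} u"
      using u_deriv by (intro DERIV_continuous_on)
  qed (use u_mem u_deriv in auto)
  then have prod: "((\<lambda>t. - (a * b / (b - a)) * ((- (a * b * (b - a)) / (A t)\<^sup>2) *\<^sub>R (f (u t) / (u t)\<^sup>2)))
      has_integral - (a * b / (b - a)) *
        (integral {u 0..u 1} (\<lambda>x. f x / x\<^sup>2) - integral {u 1..u 0} (\<lambda>x. f x / x\<^sup>2))) {0..1}"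
    by (rule has_integral_mult_right)
  have u01: "u 0 = b" "u 1 = a"
    using assms by (auto simp: u_def A_def)
  from prod have "((\<lambda>t. - (a * b / (b - a)) * ((- (a * b * (b - a)) / (A t)\<^sup>2) *\<^sub>R (f (u t) / (u t)\<^sup>2)))
      has_integral a * b / (b - a) * integral {a..b} (\<lambda>x. f x / x\<^sup>2)) {0..1}"
    by (rule has_integral_eq_rhs) (use assms u01 in simp)
  then have mean: "((\<lambda>t. f (u t)) has_integral
      a * b / (b - a) * integral {a..b} (\<lambda>x. f x / x\<^sup>2)) {0..1}"
  proof (rule has_integral_eq [rotated])
    fix t :: real assume t: "t \<in> {0..1}"
    show "- (a * b / (b - a)) * ((- (a * b * (b - a)) / (A t)\<^sup>2) *\<^sub>R (f (u t) / (u t)\<^sup>2)) = f (u t)"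
      using A(3) [OF t] assms by (simp add: u_def power2_eq_square)
  qed
  have "((\<lambda>t. (1 - 2 * t) * (f' (u t) * (- (a * b * (b - a)) / (A t)\<^sup>2)) - 2 * f (u t)) has_integral
      (1 - 2 * 1) * f (u 1) - (1 - 2 * 0) * f (u 0)) {0..1}"
    by (rule fundamental_theorem_of_calculus)
       (auto simp: has_real_derivative_iff_has_vector_derivative [symmetric]
             intro!: derivative_eq_intros fu_deriv)
  from has_integral_add [OF this has_integral_mult_right [OF mean, of 2]]
  have "((\<lambda>t. (1 - 2 * t) * (f' (u t) * (- (a * b * (b - a)) / (A t)\<^sup>2))) has_integral
      - f a - f b + 2 * (a * b / (b - a) * integral {a..b} (\<lambda>x. f x / x\<^sup>2))) {0..1}"
    by (simp add: u01)
  from has_integral_mult_right [OF this, of "- 1 / (a * b * (b - a))"]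
  have "((\<lambda>t. - 1 / (a * b * (b - a)) * ((1 - 2 * t) * (f' (u t) * (- (a * b * (b - a)) / (A t)\<^sup>2))))
      has_integral 2 / (a * b * (b - a)) * ((f a + f b) / 2
      - a * b / (b - a) * integral {a..b} (\<lambda>x. f x / x\<^sup>2))) {0..1}"
    by (rule has_integral_eq_rhs) (use assms in \<open>simp add: divide_simps, simp add: algebra_simps\<close>)
  then show ?thesis
  proof (rule has_integral_eq [rotated])
    fix t :: real assume t: "t \<in> {0..1}"
    have "A t powr (- 2) = 1 / (A t)\<^sup>2"
      using A(3) [OF t] by (simp add: powr_minus divide_inverse)
    then show "- 1 / (a * b * (b - a)) * ((1 - 2 * t) * (f' (u t) * (- (a * b * (b - a)) / (A t)\<^sup>2)))
        = (1 - 2 * t) * (t * b + (1 - t) * a) powr (- 2) * f' (a * b / (t * b + (1 - t) * a))"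
      using assms by (simp add: u_def A_def [symmetric])
  qed
qed

section \<open>The estimate\<close>

theorem theorem6:
  fixes I :: "real set" and f :: "real \<Rightarrow> real" and a b m \<alpha> q :: real
  assumes "is_interval I" and "I \<subseteq> {0<..}"
    and "\<And>x. x \<in> interior I \<Longrightarrow> f differentiable (at x)"
    and "0 < m" and "m \<le> 1"
    and "a \<in> interior I" and "b / m \<in> interior I" and "a < b"
    and "deriv f absolutely_integrable_on {a..b}"
    and "0 \<le> \<alpha>" and "\<alpha> \<le> 1" and "1 \<le> q"
    and "harmonically_convex_on \<alpha> m {a..b / m} (\<lambda>x. \<bar>deriv f x\<bar> powr q)"
  shows "\<bar>(f a + f b) / 2 - a * b / (b - a) * integral {a..b} (\<lambda>x. f x / x\<^sup>2)\<bar>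
    \<le> a * b * (b - a) / 2 * hc_lambda 0 1 a b powr (1 - 1 / q)
       * (hc_lambda \<alpha> 1 a b * \<bar>deriv f a\<bar> powr q
          + m * hc_mu \<alpha> 1 a b * \<bar>deriv f (b / m)\<bar> powr q) powr (1 / q)"
proof -
  have a: "0 < a"
    using assms(2,6) interior_subset by fastforce
  have b: "b \<le> b / m"
    using assms(4,5,8) a by (simp add: field_simps)
  have "convex (interior I)"
    using assms(1) by (simp add: is_interval_convex convex_interior)
  then have sub: "{a..b / m} \<subseteq> interior I"
    using closed_segment_subset [OF assms(6,7)] assms(8) b
    by (simp add: closed_segment_eq_real_ivl1)
  have deriv: "(f has_real_derivative deriv f x) (at x)" if "x \<in> {a..b}" for x
  proof -
    have "x \<in> interior I" using that b sub by force
    then show ?thesis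
      using assms(3) by (simp add: DERIV_deriv_iff_real_differentiable)
  qed
  define D where "D = (f a + f b) / 2 - a * b / (b - a) * integral {a..b} (\<lambda>x. f x / x\<^sup>2)"
  define A where "A t = t * b + (1 - t) * a" for t
  define P Q where "P = \<bar>deriv f a\<bar> powr q" and "Q = \<bar>deriv f (b / m)\<bar> powr q"
  define w where "w t = \<bar>1 - 2 * t\<bar> * A t powr (- 2)" for t
  define G where "G t = rpow t \<alpha> * P + m * (1 - rpow t \<alpha>) * Q" for t
  have A: "a \<le> A t" "A t \<le> b" if "t \<in> {0..1}" for t
    using convex_mean_in_interval [OF assms(8) that] by (auto simp: A_def)
  have phi: "((\<lambda>t. (1 - 2 * t) * A t powr (- 2) * deriv f (a * b / A t)) has_integral
      2 / (a * b * (b - a)) * D) {0..1}"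
    unfolding A_def D_def by (rule trapezoid_harmonic_identity [OF a assms(8) deriv])
  have w0: "(w has_integral hc_lambda 0 1 a b) {0..1}"
    using hc_lambda_has_integral [OF a assms(8), of 0 1]
    by (simp add: w_def [abs_def] A_def rpow_def)
  have w\<alpha>: "((\<lambda>t. w t * rpow t \<alpha>) has_integral hc_lambda \<alpha> 1 a b) {0..1}"
    using hc_lambda_has_integral [OF a assms(8,10), of 1]
    by (simp add: w_def A_def mult_ac)
  have wG: "((\<lambda>t. w t * G t) has_integral hc_lambda \<alpha> 1 a b * P + m * hc_mu \<alpha> 1 a b * Q) {0..1}"
  proof -
    have "((\<lambda>t. w t * rpow t \<alpha> * P + (w t - w t * rpow t \<alpha>) * (m * Q)) has_integral
        hc_lambda \<alpha> 1 a b * P + (hc_lambda 0 1 a b - hc_lambda \<alpha> 1 a b) * (m * Q)) {0..1}"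
      by (intro has_integral_add has_integral_mult_left has_integral_diff w0 w\<alpha>)
    then show ?thesis
      by (simp add: G_def hc_mu_def algebra_simps)
  qed
  have "\<bar>2 / (a * b * (b - a)) * D\<bar> \<le> hc_lambda 0 1 a b powr (1 - 1 / q)
      * (hc_lambda \<alpha> 1 a b * P + m * hc_mu \<alpha> 1 a b * Q) powr (1 / q)"
  proof (rule weighted_power_mean_bound [OF assms(12) phi w0 _ _ wG])
    show "0 < hc_lambda 0 1 a b" by (rule hc_lambda_0_pos [OF a assms(8)])
    show "0 \<le> w t" for t by (simp add: w_def)
    show "\<bar>(1 - 2 * t) * A t powr - 2 * deriv f (a * b / A t)\<bar> \<le> w t * \<bar>deriv f (a * b / A t)\<bar>" for t
      by (simp add: w_def abs_mult)
    fix t :: real assume t: "t \<in> {0..1}"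
    have "m * a * (b / m) / (m * t * (b / m) + (1 - t) * a) = a * b / A t"
      using assms(4) by (simp add: A_def)
    moreover have "a * b / A t \<in> {a..b / m}"
    proof -
      have "a \<le> a * b / A t" "a * b / A t \<le> b"
        using A [OF t] a assms(8) by (auto simp: field_simps)
      with b show ?thesis by auto
    qed
    moreover have "a \<in> {a..b / m}" "b / m \<in> {a..b / m}"
      using b assms(8) by auto
    ultimately show "\<bar>deriv f (a * b / A t)\<bar> powr q \<le> G t"
      using assms(13) t unfolding harmonically_convex_on_def G_def P_def Q_def by metis
  qed auto
  moreover have "\<bar>2 / (a * b * (b - a)) * D\<bar> = 2 / (a * b * (b - a)) * \<bar>D\<bar>"
    using a assms(8) by (simp add: abs_mult)
  ultimately have "\<bar>D\<bar> \<le> a * b * (b - a) / 2 * (hc_lambda 0 1 a b powr (1 - 1 / q)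
      * (hc_lambda \<alpha> 1 a b * P + m * hc_mu \<alpha> 1 a b * Q) powr (1 / q))"
    using a assms(8) by (simp add: field_simps)
  then show ?thesis
    by (simp add: D_def P_def Q_def mult.assoc)
qed

end
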